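(* Let $\mathcal{U}$ be a nonprincipal ultrafilter on $\mathbb{N}$. For each $k \in \mathbb{N}$ let $q_k$ be a power of a prime, and assume $\lim_{k\to\infty} q_k = \infty$. Let $\mathbb{F}_{\bar{q}} = \prod_{k\in\mathbb{N}} \mathbb{F}_{q_k}/\mathcal{U}$ be the ultraproduct of the finite fields $\mathbb{F}_{q_k}$. Fix a positive integer $n$, and let $p_1,\dots,p_r$ be the prime divisors of $n$. Then the following conditions are equivalent: (1) for every choice of elements $g_k \in \mathbb{F}_{q_k}$ such that each $g_k$ is a generator of the cyclic group $\mathbb{F}_{q_k}^\times$, the binomial $x^n - g$ is irreducible over $\mathbb{F}_{\bar{q}}$, where $g \in \mathbb{F}_{\bar{q}}$ is the class of the sequence $(g_k)_{k\in\mathbb{N}}$ modulo $\mathcal{U}$; (2) there exists $g \in \mathbb{F}_{\bar{q}}$ such that $x^n - g$ is irreducible over $\mathbb{F}_{\bar{q}}$; (3) the set of $k \in \mathbb{N}$ such that $p_1, p_2, \dots, p_r$ all divide $q_k - 1$ and, if $4 \mid n$, also $4 \mid q_k - 1$, belongs to $\mathcal{U}$.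
   Context: $\mathbb{F}_{q}$ denotes the finite field with $q$ elements and $\mathbb{F}_q^\times$ its multiplicative group. The ultraproduct $\prod_{k} \mathbb{F}_{q_k}/\mathcal{U}$ is the quotient of the product ring by the equivalence relation identifying sequences that agree on a set in $\mathcal{U}$; it is a field (a pseudofinite field). *)

theory Defs
  imports "HOL-Algebra.Algebra" "HOL-Number_Theory.Prime_Powers"
begin

text \<open>
  Filters on an index set are elements of the library type \<open>'i filter\<close>; membership of a set
  \<open>A\<close> in the filter \<open>U\<close> reads \<open>eventually (\<lambda>i. i \<in> A) U\<close>.
\<close>

definition ultrafilter :: "'i filter \<Rightarrow> bool"
  where "ultrafilter U \<longleftrightarrow> U \<noteq> bot \<and> (\<forall>P. eventually P U \<or> eventually (\<lambda>i. \<not> P i) U)"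

definition nonprincipal :: "'i filter \<Rightarrow> bool"
  where "nonprincipal U \<longleftrightarrow> (\<nexists>i. U = principal {i})"

definition product_ring :: "('i \<Rightarrow> ('a, 'b) ring_scheme) \<Rightarrow> ('i \<Rightarrow> 'a) ring"
  where "product_ring R =
    \<lparr>carrier = (\<Pi> i\<in>UNIV. carrier (R i)),
     monoid.mult = (\<lambda>f g i. f i \<otimes>\<^bsub>R i\<^esub> g i),
     one = (\<lambda>i. \<one>\<^bsub>R i\<^esub>),
     ring.zero = (\<lambda>i. \<zero>\<^bsub>R i\<^esub>),
     ring.add = (\<lambda>f g i. f i \<oplus>\<^bsub>R i\<^esub> g i)\<rparr>"

definition ultra_rel :: "'i filter \<Rightarrow> ('i \<Rightarrow> ('a, 'b) ring_scheme) \<Rightarrow> (('i \<Rightarrow> 'a) \<times> ('i \<Rightarrow> 'a)) set"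
  where "ultra_rel U R =
    {(f, g). f \<in> carrier (product_ring R) \<and> g \<in> carrier (product_ring R) \<and>
             eventually (\<lambda>i. f i = g i) U}"

definition ultra_ideal :: "'i filter \<Rightarrow> ('i \<Rightarrow> ('a, 'b) ring_scheme) \<Rightarrow> ('i \<Rightarrow> 'a) set"
  where "ultra_ideal U R =
    {f \<in> carrier (product_ring R). eventually (\<lambda>i. f i = \<zero>\<^bsub>R i\<^esub>) U}"

text \<open>
  The quotient by \<open>ultra_rel U R\<close> is taken in the form of the library's quotient ring, i.e. modulo
  the ideal of the sequences equivalent to \<open>0\<close>. The cosets are exactly the equivalence classes of
  \<open>ultra_rel U R\<close>: see \<open>ultra_class_eq_Image\<close> and \<open>carrier_ultraproduct\<close> below.
\<close>

definition ultraproduct :: "'i filter \<Rightarrow> ('i \<Rightarrow> ('a, 'b) ring_scheme) \<Rightarrow> ('i \<Rightarrow> 'a) set ring"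
  where "ultraproduct U R = product_ring R Quot ultra_ideal U R"

definition ultra_class :: "'i filter \<Rightarrow> ('i \<Rightarrow> ('a, 'b) ring_scheme) \<Rightarrow> ('i \<Rightarrow> 'a) \<Rightarrow> ('i \<Rightarrow> 'a) set"
  where "ultra_class U R f = ultra_ideal U R +>\<^bsub>product_ring R\<^esub> f"

definition group_generator :: "('a, 'b) monoid_scheme \<Rightarrow> 'a \<Rightarrow> bool"
  where "group_generator G g \<longleftrightarrow> g \<in> carrier G \<and> generate G {g} = carrier G"

definition binomial_poly :: "('a, 'b) ring_scheme \<Rightarrow> nat \<Rightarrow> 'a \<Rightarrow> 'a list"
  where "binomial_poly K n a =
    X\<^bsub>K\<^esub> [^]\<^bsub>poly_ring K\<^esub> n \<ominus>\<^bsub>poly_ring K\<^esub> ring.poly_of_const K a"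

lemma product_ring_cring:
  assumes "\<And>i. cring (R i)"
  shows "cring (product_ring R)"
proof -
  have r: "ring (R i)" for i using assms by (simp add: cring_def)
  show ?thesis
  proof (rule cringI)
    show "abelian_group (product_ring R)"
    proof (rule abelian_groupI)
      fix x assume "x \<in> carrier (product_ring R)"
      then have "(\<lambda>i. \<ominus>\<^bsub>R i\<^esub> x i) \<in> carrier (product_ring R) \<and>
            (\<lambda>i. \<ominus>\<^bsub>R i\<^esub> x i) \<oplus>\<^bsub>product_ring R\<^esub> x = \<zero>\<^bsub>product_ring R\<^esub>"
        using r
        by (auto simp: product_ring_def Pi_iff abelian_group.l_neg ring.is_abelian_group
            intro!: ext abelian_group.a_inv_closed)
      then show "\<exists>y\<in>carrier (product_ring R). y \<oplus>\<^bsub>product_ring R\<^esub> x = \<zero>\<^bsub>product_ring R\<^esub>"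
        by blast
    qed (use r in \<open>auto simp: product_ring_def Pi_iff ring.ring_simprules\<close>)
    show "Group.comm_monoid (product_ring R)"
      using assms by (unfold_locales) (auto simp: product_ring_def Pi_iff cring.cring_simprules fun_eq_iff
            monoid.r_one[OF ring.is_monoid[OF r]])
  qed (use r in \<open>auto simp: product_ring_def Pi_iff ring.ring_simprules\<close>)
qed

lemma product_ring_minus:
  assumes "\<And>i. cring (R i)" "f \<in> carrier (product_ring R)"
  shows "\<ominus>\<^bsub>product_ring R\<^esub> f = (\<lambda>i. \<ominus>\<^bsub>R i\<^esub> f i)"
proof -
  interpret P: cring "product_ring R" by (rule product_ring_cring[OF assms(1)])
  have "(\<lambda>i. \<ominus>\<^bsub>R i\<^esub> f i) \<in> carrier (product_ring R)"
    "(\<lambda>i. \<ominus>\<^bsub>R i\<^esub> f i) \<oplus>\<^bsub>product_ring R\<^esub> f = \<zero>\<^bsub>product_ring R\<^esub>"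
    using assms by (auto simp: product_ring_def Pi_iff cring.cring_simprules)
  then show ?thesis using P.minus_equality assms(2) by blast
qed

lemma ultra_ideal:
  assumes c: "\<And>i. cring (R i)"
  shows "ideal (ultra_ideal U R) (product_ring R)"
proof -
  interpret P: cring "product_ring R" by (rule product_ring_cring[OF c])
  show ?thesis
  proof (rule idealI)
    show "subgroup (ultra_ideal U R) (add_monoid (product_ring R))"
    proof (rule P.add.subgroupI)
      have "\<zero>\<^bsub>product_ring R\<^esub> \<in> ultra_ideal U R"
        unfolding ultra_ideal_def using P.zero_closed by (simp add: product_ring_def)
      then show "ultra_ideal U R \<noteq> {}" by blast
    next
      fix a assume "a \<in> ultra_ideal U R"
      then show "\<ominus>\<^bsub>product_ring R\<^esub> a \<in> ultra_ideal U R"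
        using P.a_inv_closed[of a]
        by (auto simp: ultra_ideal_def product_ring_minus[OF c] cring.cring_simprules[OF c]
            elim: eventually_mono)
    next
      fix a b assume ab: "a \<in> ultra_ideal U R" "b \<in> ultra_ideal U R"
      then have "eventually (\<lambda>i. a i = \<zero>\<^bsub>R i\<^esub> \<and> b i = \<zero>\<^bsub>R i\<^esub>) U"
        by (simp add: ultra_ideal_def eventually_conj)
      then have "eventually (\<lambda>i. (a \<oplus>\<^bsub>product_ring R\<^esub> b) i = \<zero>\<^bsub>R i\<^esub>) U"
        by (rule eventually_mono) (simp add: product_ring_def cring.cring_simprules[OF c])
      then show "a \<oplus>\<^bsub>product_ring R\<^esub> b \<in> ultra_ideal U R"
        using ab by (simp add: ultra_ideal_def)
    qed (auto simp: ultra_ideal_def)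
  next
    fix a x assume ax: "a \<in> ultra_ideal U R" "x \<in> carrier (product_ring R)"
    then have "eventually (\<lambda>i. a i = \<zero>\<^bsub>R i\<^esub>) U" by (simp add: ultra_ideal_def)
    then have "eventually (\<lambda>i. (x \<otimes>\<^bsub>product_ring R\<^esub> a) i = \<zero>\<^bsub>R i\<^esub>) U"
      by (rule eventually_mono)
        (use ax(2) in \<open>auto simp: product_ring_def Pi_iff cring.cring_simprules[OF c]\<close>)
    then show xa: "x \<otimes>\<^bsub>product_ring R\<^esub> a \<in> ultra_ideal U R"
      using ax by (simp add: ultra_ideal_def)
    then show "a \<otimes>\<^bsub>product_ring R\<^esub> x \<in> ultra_ideal U R"
      using P.m_comm[of a x] ax by (simp add: ultra_ideal_def)
  qed (rule P.ring_axioms)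
qed

lemma ultra_class_eq_Image:
  assumes c: "\<And>i. cring (R i)" and f: "f \<in> carrier (product_ring R)"
  shows "ultra_class U R f = ultra_rel U R `` {f}"
proof -
  interpret P: cring "product_ring R" by (rule product_ring_cring[OF c])
  have "g \<in> ultra_class U R f \<longleftrightarrow> g \<in> ultra_rel U R `` {f}" for g
  proof
    assume "g \<in> ultra_class U R f"
    then obtain h where h: "h \<in> ultra_ideal U R" "g = h \<oplus>\<^bsub>product_ring R\<^esub> f"
      by (auto simp: ultra_class_def a_r_coset_def')
    then have g: "g \<in> carrier (product_ring R)" using f by (simp add: ultra_ideal_def)
    have "eventually (\<lambda>i. h i = \<zero>\<^bsub>R i\<^esub>) U" using h by (simp add: ultra_ideal_def)
    then have "eventually (\<lambda>i. f i = g i) U"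
      by (rule eventually_mono)
        (use f h(2) in \<open>auto simp: product_ring_def Pi_iff cring.cring_simprules[OF c]\<close>)
    then show "g \<in> ultra_rel U R `` {f}" using f g by (simp add: ultra_rel_def)
  next
    assume "g \<in> ultra_rel U R `` {f}"
    then have g: "g \<in> carrier (product_ring R)" and e: "eventually (\<lambda>i. f i = g i) U"
      by (auto simp: ultra_rel_def)
    define h where "h = g \<oplus>\<^bsub>product_ring R\<^esub> (\<ominus>\<^bsub>product_ring R\<^esub> f)"
    have hc: "h \<in> carrier (product_ring R)" using f g by (simp add: h_def)
    have fi: "f i \<in> carrier (R i)" for i using f by (simp add: product_ring_def Pi_iff)
    have "h i = g i \<oplus>\<^bsub>R i\<^esub> \<ominus>\<^bsub>R i\<^esub> f i" for i
      by (simp add: h_def product_ring_minus[OF c f]) (simp add: product_ring_def)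
    moreover have "g i \<oplus>\<^bsub>R i\<^esub> \<ominus>\<^bsub>R i\<^esub> f i = \<zero>\<^bsub>R i\<^esub>" if "f i = g i" for i
      using fi[of i] that by (simp add: cring.cring_simprules[OF c])
    ultimately have "eventually (\<lambda>i. h i = \<zero>\<^bsub>R i\<^esub>) U"
      using e by (auto elim!: eventually_mono)
    then have "h \<in> ultra_ideal U R" using hc by (simp add: ultra_ideal_def)
    moreover have "g = h \<oplus>\<^bsub>product_ring R\<^esub> f"
      using f g by (simp add: h_def P.a_assoc P.l_neg)
    ultimately show "g \<in> ultra_class U R f"
      by (auto simp: ultra_class_def a_r_coset_def')
  qed
  then show ?thesis by blast
qed

lemma carrier_ultraproduct:
  assumes c: "\<And>i. cring (R i)"
  shows "carrier (ultraproduct U R) = carrier (product_ring R) // ultra_rel U R"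
proof -
  have "carrier (ultraproduct U R) = ultra_class U R ` carrier (product_ring R)"
    by (auto simp: ultraproduct_def FactRing_def A_RCOSETS_def RCOSETS_def ultra_class_def
        a_r_coset_def)
  also have "\<dots> = (\<lambda>f. ultra_rel U R `` {f}) ` carrier (product_ring R)"
    by (rule image_cong) (simp_all add: ultra_class_eq_Image[OF c])
  finally show ?thesis
    by (auto simp: quotient_def)
qed

end

theory Submission
  imports Defs "HOL-Number_Theory.Cong"
begin

text \<open>
  If condition (3) fails on a set in the ultrafilter, then either every element of
  the ultraproduct is a \<open>p\<close>-th power for some prime \<open>p\<close> dividing \<open>n\<close>, or \<open>4\<close> divides \<open>n\<close> and for
  every \<open>x\<close> one of \<open>x\<close>, \<open>-x\<close> is a square. In the first case \<open>X^m - b\<close> divides \<open>X^(pm) - b^p\<close>; in the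
  second every non-square has the form \<open>-e^2\<close> with \<open>2 e = d^2\<close>, so \<open>X^(4m) + e^2\<close> splits as in Sophie
  Germain's identity.

  Conversely, let \<open>g\<close> generate the multiplicative group of a field with \<open>q\<close> elements satisfying (3).
  A root \<open>x\<close> of an irreducible factor of degree \<open>d\<close> of \<open>X^n - g\<close> has order \<open>n (q - 1)\<close> in a field with
  \<open>q^d\<close> elements, because every prime divisor of \<open>n\<close> divides the order \<open>q - 1\<close> of \<open>x^n = g\<close>. So \<open>n\<close>
  divides \<open>1 + q + \<dots> + q^(d-1)\<close>, and the congruences for \<open>q\<close> force \<open>n\<close> to divide \<open>d\<close>. Irreducibility
  passes to the ultraproduct, since a factorization there involves finitely many coefficients.
\<close>

section \<open>Divisibility of geometric sums\<close>

lemma sum_lessThan_add: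
  fixes f :: "nat \<Rightarrow> 'a :: comm_monoid_add"
  shows "(\<Sum>i<m + k. f i) = (\<Sum>i<m. f i) + (\<Sum>i<k. f (m + i))"
  by (induction k) (simp_all add: add.assoc)

text \<open>The exponents below \<open>a * b\<close> split into \<open>b\<close> consecutive blocks
  of length \<open>a\<close>, each a power of \<open>q ^ a\<close> times the first. With
  \<open>a\<close> prime this peels one prime off the number of summands, at the price of replacing
  \<open>q\<close> by \<open>q ^ a\<close>.\<close>

lemma geometric_sum_mult:
  fixes q :: "'a :: comm_semiring_1"
  shows "(\<Sum>i<a * b. q ^ i) = (\<Sum>i<a. q ^ i) * (\<Sum>j<b. (q ^ a) ^ j)"
proof (induction b)
  case (Suc b)
  have "(\<Sum>i<a * Suc b. q ^ i) = (\<Sum>i<a * b. q ^ i) + (\<Sum>i<a. q ^ (a * b + i))"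
    by (simp add: add.commute[of a] sum_lessThan_add)
  also have "(\<Sum>i<a. q ^ (a * b + i)) = (\<Sum>i<a. q ^ i) * (q ^ a) ^ b"
    by (simp add: power_add power_mult sum_distrib_right mult.commute)
  finally show ?case
    using Suc by (simp add: algebra_simps)
qed simp

lemma geometric_sum_cong:
  fixes q :: nat
  assumes "[q = 1] (mod l)"
  shows "[(\<Sum>i<m. q ^ i) = m] (mod l)"
proof -
  have "[(\<Sum>i<m. q ^ i) = (\<Sum>i<m. 1)] (mod l)"
    using cong_pow[OF assms] by (intro cong_sum) simp
  then show ?thesis by simp
qed

text \<open>Write q = 1 + p t. Modulo p^2 the expansion of q^i stops after the linear term, so the
  sum is p + p t (0 + ... + (p - 1)), and the inner sum is a multiple of p since p is odd. For p = 2
  this breaks down (q = 3 gives 4), which is where the condition on 4 comes from.\<close>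

lemma geometric_sum_cong_square:
  fixes p q :: nat
  assumes "Factorial_Ring.prime p" "odd p" "[q = 1] (mod p)"
  shows "[(\<Sum>i<p. q ^ i) = p] (mod p * p)"
proof -
  have "q \<noteq> 0"
    using assms(3) prime_gt_1_nat[OF assms(1)] cong_0_1_nat[of p] by (intro notI) simp
  then obtain t where t: "q = 1 + p * t"
    using cong_to_1_nat[OF assms(3)] by (metis dvdE le_add_diff_inverse less_one linorder_not_le)
  have "[q ^ i = 1 + i * (p * t)] (mod p * p)" for i
  proof (induction i)
    case (Suc i)
    have "[q ^ Suc i = q * (1 + i * (p * t))] (mod p * p)"
      using cong_scalar_left[OF Suc, of q] by simp
    also have "q * (1 + i * (p * t)) = 1 + Suc i * (p * t) + (p * p) * (i * t * t)"
      by (simp add: t algebra_simps)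
    finally show ?case
      by (simp add: cong_def del: power_Suc)
  qed simp
  then have "[(\<Sum>i<p. q ^ i) = (\<Sum>i<p. 1 + i * (p * t))] (mod p * p)"
    by (intro cong_sum)
  also have "(\<Sum>i<p. 1 + i * (p * t)) = p + (p * t) * (\<Sum>i<p. i)"
    by (simp only: sum.distrib sum_distrib_left mult.commute[of _ "p * t"]) simp
  also have "(\<Sum>i<p. i) = p * ((p - 1) div 2)"
    using assms(2) Sum_Ico_nat[of 0 p] by (simp add: atLeast0LessThan div_mult_swap)
  also have "p + (p * t) * (p * ((p - 1) div 2)) = p + (p * p) * (t * ((p - 1) div 2))"
    by (simp add: algebra_simps)
  finally show ?thesis
    by (simp add: cong_def)
qed

text \<open>Strong induction on \<open>n\<close>, removing a prime p with n = p n'. Modulo p the sum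
  is m, so m = p m', and the sum is the p-term sum \<open>p * u\<close> times the m'-term sum for
  q^p. As u is coprime to n', n' divides the latter, and induction applies to n', q^p and
  m'.\<close>

lemma dvd_of_dvd_geometric_sum:
  fixes n q m :: nat
  assumes "n > 0" "n dvd (\<Sum>i<m. q ^ i)"
    and "\<And>p. Factorial_Ring.prime p \<Longrightarrow> p dvd n \<Longrightarrow> [q = 1] (mod p)"
    and "4 dvd n \<Longrightarrow> [q = 1] (mod 4)"
  shows "n dvd m"
  using assms
proof (induction n arbitrary: q m rule: less_induct)
  case (less n)
  show ?case
  proof (cases "n = 1")
    case False
    then obtain p where p: "Factorial_Ring.prime p" "p dvd n"
      using prime_factor_nat by blast
    then obtain n' where n: "n = p * n'" by blast
    have q: "[q = 1] (mod p)"
      using less.prems(3) p by blast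
    have "p dvd m"
      using dvd_trans[OF p(2) less.prems(2)] cong_dvd_iff[OF geometric_sum_cong[OF q]] by blast
    then obtain m' where m: "m = p * m'" by blast
    have "p dvd (\<Sum>i<p. q ^ i)"
      using cong_dvd_iff[OF geometric_sum_cong[OF q], of p] by simp
    then obtain u where u: "(\<Sum>i<p. q ^ i) = p * u" by blast
    have "p * n' dvd p * (u * (\<Sum>j<m'. (q ^ p) ^ j))"
      using less.prems(2) by (simp add: n m geometric_sum_mult u mult.assoc)
    then have dvd: "n' dvd u * (\<Sum>j<m'. (q ^ p) ^ j)"
      using p(1) by (simp add: prime_gt_0_nat)
    \<comment> \<open>A common prime l of n' and u divides the p-term sum, which is p modulo l; so l
      = p, and p^2 divides both n and that sum. For odd p the sum is p modulo p^2; for p = 2 it is q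
      + 1, which is 2 modulo 4 because 4 divides n.\<close>
    have "coprime n' u"
    proof (rule ccontr)
      assume "\<not> coprime n' u"
      then have "gcd n' u \<noteq> 1"
        by (simp only: coprime_iff_gcd_eq_1 not_False_eq_True)
      then obtain l where "Factorial_Ring.prime l" "l dvd gcd n' u"
        using prime_factor_nat by blast
      then have l: "Factorial_Ring.prime l" "l dvd n'" "l dvd u"
        by simp_all
      have "[q = 1] (mod l)"
        using less.prems(3) l by (simp add: n)
      then have "l dvd p"
        using cong_dvd_iff[OF geometric_sum_cong, of q l p] l(3) u by simp
      then have "l = p"
        using p(1) l(1) primes_dvd_imp_eq by blast
      then have pp: "p * p dvd (\<Sum>i<p. q ^ i)" "p * p dvd n"
        using l by (auto simp: u n)
      show False
      proof (cases "odd p")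
        case True
        then have "p * p dvd p"
          using cong_dvd_iff[OF geometric_sum_cong_square[OF p(1) _ q]] pp(1) by blast
        then show False
          using p(1) prime_gt_1_nat[of p] by (auto dest!: dvd_imp_le)
      next
        case False
        then have "p = 2"
          using p(1) primes_dvd_imp_eq two_is_prime_nat by blast
        moreover have "(\<Sum>i<2. q ^ i) = Suc q"
          by (simp add: numeral_2_eq_2)
        ultimately have "[q = 1] (mod 4)" "4 dvd Suc q"
          using less.prems(4) pp by simp_all
        then show False
          by (simp add: cong_def) presburger
      qed
    qed
    then have "n' dvd (\<Sum>j<m'. (q ^ p) ^ j)"
      using dvd coprime_dvd_mult_right_iff by blast
    moreover have "n' < n" "n' > 0"
      using n less.prems(1) p(1) prime_gt_1_nat[of p] by auto
    moreover have "[q ^ p = 1] (mod l)" if "Factorial_Ring.prime l" "l dvd n'" for l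
      using cong_pow[OF less.prems(3)[of l], of p] that by (simp add: n)
    moreover have "[q ^ p = 1] (mod 4)" if "4 dvd n'"
      using cong_pow[OF less.prems(4), of p] that by (simp add: n)
    ultimately have "n' dvd m'"
      using less.IH by blast
    then show ?thesis
      by (simp add: n m)
  qed simp
qed

text \<open>Cancelling q - 1 leaves the geometric sum. In the application \<open>n * (q - 1)\<close>
  divides the order of a root and \<open>q ^ d - 1\<close> is the size of the unit group containing
  it.\<close>

lemma dvd_of_mult_dvd_power_minus_one:
  fixes n q d :: nat
  assumes "n > 0" "q > 1" "n * (q - 1) dvd q ^ d - 1"
    and "\<And>p. Factorial_Ring.prime p \<Longrightarrow> p dvd n \<Longrightarrow> p dvd q - 1"
    and "4 dvd n \<Longrightarrow> 4 dvd q - 1"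
  shows "n dvd d"
proof (rule dvd_of_dvd_geometric_sum)
  have "q ^ d - 1 = (\<Sum>i<d. q ^ i) * (q - 1)"
  proof -
    have "int (q ^ d - 1) = int ((\<Sum>i<d. q ^ i) * (q - 1))"
      using assms(2) power_diff_1_eq[of "int q" d] by (simp add: of_nat_diff mult.commute)
    then show ?thesis by (simp only: of_nat_eq_iff)
  qed
  then show "n dvd (\<Sum>i<d. q ^ i)"
    using assms(2,3) by simp
  show "[q = 1] (mod p)" if "Factorial_Ring.prime p" "p dvd n" for p
    using assms(2) assms(4)[OF that] by (simp add: cong_altdef_nat)
  show "[q = 1] (mod 4)" if "4 dvd n"
    using assms(2) assms(5)[OF that] by (simp add: cong_altdef_nat)
qed (rule assms(1))

text \<open>One has ord x = ord (x^n) t with t = gcd (ord x, n). The cofactor s = n / t is coprime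
  to ord (x^n), while every prime factor of s divides n and hence that order. So s = 1 and t =
  n.\<close>

lemma (in group) mult_ord_pow_dvd_ord:
  assumes x: "x \<in> carrier G" and "n > 0" "ord x > 0"
    and primes: "\<And>p. Factorial_Ring.prime p \<Longrightarrow> p dvd n \<Longrightarrow> p dvd ord (x [^] n)"
  shows "n * ord (x [^] n) dvd ord x"
proof -
  define t where "t = gcd (ord x) n"
  have t0: "t > 0" using assms by (simp add: t_def)
  have ordx: "ord x = ord (x [^] n) * t"
    using ord_pow_gen[OF x, of n] assms(2) by (simp add: t_def)
  obtain s where s: "n = t * s" unfolding t_def by (metis dvdE gcd_dvd2)
  have "gcd (t * ord (x [^] n)) (t * s) = t"
    using t_def ordx[symmetric] s by (simp only: mult.commute)
  then have "t * gcd (ord (x [^] n)) s = t"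
    by (simp only: gcd_mult_distrib_nat)
  then have "gcd (ord (x [^] n)) s = 1"
    using t0 by simp
  then have cop: "coprime (ord (x [^] n)) s"
    by (simp only: coprime_iff_gcd_eq_1)
  have "s = 1"
  proof (rule ccontr)
    assume "s \<noteq> 1"
    then obtain p where p: "Factorial_Ring.prime p" "p dvd s"
      using prime_factor_nat by blast
    then have "p dvd ord (x [^] n)"
      using primes s by simp
    then show False
      using cop p coprime_common_divisor not_prime_unit by blast
  qed
  then show ?thesis using ordx s by (simp add: mult.commute)
qed

section \<open>Binomials over finite fields\<close>

text \<open>Every class modulo \<open>p\<close> has exactly one representative of degree below that
  of \<open>p\<close>, and such a representative amounts to a free choice of \<open>degree p\<close>
  coefficients.\<close>

lemma (in domain) card_rupture:
  assumes K: "subfield K R" "finite K" and p: "p \<in> carrier (K[X])" "p \<noteq> []"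
  shows "card (carrier (Rupt K p)) = card K ^ degree p"
proof -
  let ?L = "{xs. set xs \<subseteq> K \<and> length xs = degree p}"
  let ?P = "{q \<in> carrier (K[X]). length q \<le> degree p}"
  have zero: "\<zero> \<in> K"
    using subringE(2)[OF subfieldE(1)[OF K(1)]] .
  \<comment> \<open>Polynomials are lists without leading zeros, so stripping leading zeros with
    \<open>normalize\<close> and padding with zeros to full length are mutually inverse.\<close>
  have "bij_betw normalize ?L ?P"
  proof (rule bij_betw_byWitness[where f' = "\<lambda>q. replicate (degree p - length q) \<zero> @ q"])
    show "\<forall>xs\<in>?L. replicate (degree p - length (normalize xs)) \<zero> @ normalize xs = xs"
    proof
      fix xs assume "xs \<in> ?L"
      then have "degree p = length xs"
        by simp
      then show "replicate (degree p - length (normalize xs)) \<zero> @ normalize xs = xs"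
        using normalize_trick[of xs, symmetric] by (simp only:)
    qed
    show "\<forall>q\<in>?P. normalize (replicate (degree p - length q) \<zero> @ q) = q"
      by (auto simp: normalize_replicate_zero normalize_polynomial univ_poly_carrier)
    show "normalize ` ?L \<subseteq> ?P"
    proof
      fix q assume "q \<in> normalize ` ?L"
      then obtain xs where xs: "set xs \<subseteq> K" "length xs = degree p" "q = normalize xs"
        by blast
      then show "q \<in> ?P"
        using normalize_gives_polynomial[OF xs(1)] normalize_length_le[of xs]
        by (simp add: univ_poly_carrier)
    qed
    show "(\<lambda>q. replicate (degree p - length q) \<zero> @ q) ` ?P \<subseteq> ?L"
    proof
      fix xs assume "xs \<in> (\<lambda>q. replicate (degree p - length q) \<zero> @ q) ` ?P"
      then obtain q where q: "q \<in> carrier (K[X])" "length q \<le> degree p"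
        "xs = replicate (degree p - length q) \<zero> @ q"
        by blast
      have "set q \<subseteq> K"
        using polynomial_incl q(1) unfolding univ_poly_carrier[symmetric] .
      then show "xs \<in> ?L"
        using zero q(2,3) by auto
    qed
  qed
  then have "card ?P = card K ^ degree p"
    using bij_betw_same_card[of normalize ?L ?P] card_lists_length_eq[OF K(2), of "degree p"] by simp
  moreover have "bij_betw (rupture_surj K p) ?P (carrier (Rupt K p))"
    using rupture_carrier_as_pmod_image[OF K(1) p(1)] rupture_surj_inj_on[OF K(1) p(1)]
    unfolding pmod_image_characterization[OF K(1) p] bij_betw_def by blast
  ultimately show ?thesis
    using bij_betw_same_card by fastforce
qed

section \<open>Binomials as coefficient lists\<close>

lemma (in domain) binomial_poly_closed:
  assumes "a \<in> carrier R"
  shows "binomial_poly R n a \<in> carrier (poly_ring R)"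
proof -
  interpret UP: domain "poly_ring R"
    using univ_poly_is_domain[OF carrier_is_subring] .
  show ?thesis
    using var_pow_closed[OF carrier_is_subring]
      ring_hom_memE(1)[OF canonical_embedding_is_hom[OF carrier_is_subring]] assms
    by (simp add: binomial_poly_def)
qed

text \<open>The leading coefficient stands first. The degree is read off from this list, and the
  passage to the ultraproduct lifts it coefficient by coefficient.\<close>

lemma (in domain) binomial_poly_eq:
  assumes a: "a \<in> carrier R" and "n > 0"
  shows "binomial_poly R n a = \<one> # replicate (n - 1) \<zero> @ [\<ominus> a]"
proof -
  interpret UP: domain "poly_ring R"
    using univ_poly_is_domain[OF carrier_is_subring] .
  interpret C: ring_hom_ring "R \<lparr>carrier := carrier R\<rparr>" "poly_ring R" poly_of_const
    using canonical_embedding_ring_hom[OF carrier_is_subring] .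
  let ?p = "\<one> # replicate (n - 1) \<zero>"
  have C: "poly_of_const (\<ominus> a) = \<ominus>\<^bsub>poly_ring R\<^esub> poly_of_const a"
    using C.hom_a_inv[of a] a by simp
  have "X [^]\<^bsub>poly_ring R\<^esub> n = ?p @ replicate (length [\<ominus> a]) \<zero>"
    using unitary_monom_eq_var_pow[OF carrier_is_subring, of n] \<open>n > 0\<close>
    by (cases n) (simp_all add: monom_def replicate_append_same)
  then have "binomial_poly R n a
      = poly_add (?p @ replicate (length [\<ominus> a]) \<zero>) (normalize [\<ominus> a])"
    by (simp add: binomial_poly_def a_minus_def univ_poly_add flip: C)
      (simp add: poly_of_const_def)
  also have "\<dots> = normalize (?p @ [\<ominus> a])"
    using a by (subst poly_add_normalize(2)[symmetric], force, force)
      (rule poly_add_append_replicate, auto)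
  finally show ?thesis
    by simp
qed

lemma (in domain) degree_binomial_poly:
  assumes "a \<in> carrier R" "n > 0"
  shows "degree (binomial_poly R n a) = n"
  using assms by (simp add: binomial_poly_eq)

text \<open>The zero polynomial \<open>[]\<close> has degree 0, so additivity of degrees is stated
  for a nonzero product.\<close>

lemma (in domain) poly_ring_degree_mult:
  assumes "p \<in> carrier (poly_ring R)" "q \<in> carrier (poly_ring R)"
    and "p \<otimes>\<^bsub>poly_ring R\<^esub> q \<noteq> []"
  shows "degree (p \<otimes>\<^bsub>poly_ring R\<^esub> q) = degree p + degree q" "p \<noteq> []" "q \<noteq> []"
proof -
  show "p \<noteq> []" "q \<noteq> []"
    using assms poly_mult_zero[OF polynomial_in_carrier[OF carrier_is_subring]]
    by (auto simp: univ_poly_mult univ_poly_carrier)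
  then show "degree (p \<otimes>\<^bsub>poly_ring R\<^esub> q) = degree p + degree q"
    using poly_mult_degree_eq[OF carrier_is_subring] assms by (simp add: univ_poly_mult univ_poly_carrier)
qed

text \<open>With q the size of the base field, the rupture field of \<open>f\<close> has q^(deg f)
  elements, and the class x of X in it is a root of the binomial. There x^n has the order q - 1 of
  \<open>a\<close>, so n (q - 1) divides ord x, which divides q^(deg f) - 1 by Lagrange.\<close>

lemma (in field) dvd_degree_irreducible_divisor_binomial:
  assumes fin: "finite (carrier R)" and a: "a \<in> carrier R" "a \<noteq> \<zero>" and "n > 0"
    and ord: "group.ord (units_of R) a = card (carrier R) - 1"
    and primes: "\<And>p. Factorial_Ring.prime p \<Longrightarrow> p dvd n \<Longrightarrow> p dvd card (carrier R) - 1"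
    and four: "4 dvd n \<Longrightarrow> 4 dvd card (carrier R) - 1"
    and f: "f \<in> carrier (poly_ring R)" "pirreducible (carrier R) f" "f pdivides binomial_poly R n a"
  shows "n dvd degree f"
proof -
  let ?q = "card (carrier R)" and ?P = "poly_ring R" and ?L = "Rupt (carrier R) f"
  let ?s = "rupture_surj (carrier R) f"
  interpret UP: domain ?P
    using univ_poly_is_domain[OF carrier_is_subring] .
  interpret L: field ?L
    using rupture_is_field_iff_pirreducible[OF carrier_is_subfield f(1)] f(2) by blast
  interpret H: ring_hom_ring ?P ?L ?s
    using rupture_surj_hom(2)[OF carrier_is_subring f(1)] .
  have f0: "f \<noteq> []" "degree f > 0"
    using pirreducibleE(1)[OF carrier_is_subring f(1,2)]
      pirreducible_degree[OF carrier_is_subfield f(1,2)] by auto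
  \<comment> \<open>\<open>h\<close> embeds the base field as the classes of constants; being
    injective, it preserves orders of elements.\<close>
  define h where "h = ?s \<circ> poly_of_const"
  interpret h: ring_hom_ring R ?L h
    using rupture_surj_norm_is_hom[OF carrier_is_subring f(1)] ring_axioms L.ring_axioms
    by (simp add: h_def ring_hom_ring_def ring_hom_ring_axioms_def)
  have "inj_on h (carrier R)"
  proof (rule h.non_trivial_field_hom_imp_inj[OF field_axioms])
    have "h \<one> \<in> h ` carrier R"
      by (rule imageI) simp
    moreover have "h \<one> \<noteq> \<zero>\<^bsub>?L\<^esub>"
      using h.hom_one by simp
    ultimately show "h ` carrier R \<noteq> {\<zero>\<^bsub>?L\<^esub>}"
      by blast
  qed
  then have h_inj: "h x = h y \<longleftrightarrow> x = y" if "x \<in> carrier R" "y \<in> carrier R" for x y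
    using that by (simp add: inj_on_eq_iff)
  have X: "X \<in> carrier ?P"
    using var_closed(1)[OF carrier_is_subring] .
  have ca: "poly_of_const a \<in> carrier ?P"
    using ring_hom_memE(1)[OF canonical_embedding_is_hom[OF carrier_is_subring]] a by simp
  define x where "x = ?s X"
  have x: "x \<in> carrier ?L"
    using X by (simp add: x_def)
  have "?s (binomial_poly R n a) = \<zero>\<^bsub>?L\<^esub>"
  proof -
    obtain r where r: "r \<in> carrier ?P" "binomial_poly R n a = f \<otimes>\<^bsub>?P\<^esub> r"
      using f(3) by (auto simp: pdivides_def)
    have "?s f = \<zero>\<^bsub>?L\<^esub>"
      using UP.a_rcos_zero[OF UP.cgenideal_ideal[OF f(1)] UP.cgenideal_self[OF f(1)]]
      unfolding rupture_def FactRing_def by simp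
    then show ?thesis
      using r f(1) by simp
  qed
  then have "x [^]\<^bsub>?L\<^esub> n \<ominus>\<^bsub>?L\<^esub> h a = \<zero>\<^bsub>?L\<^esub>"
    using X ca by (simp add: binomial_poly_def a_minus_def h_def x_def H.hom_nat_pow)
  then have xn: "x [^]\<^bsub>?L\<^esub> n = h a"
    using x a by (simp add: L.r_right_minus_eq)
  have ha: "h a \<noteq> \<zero>\<^bsub>?L\<^esub>"
    using h_inj[of a \<zero>] a by simp
  then have "x \<noteq> \<zero>\<^bsub>?L\<^esub>"
    using xn \<open>n > 0\<close> L.nat_pow_zero[of n] by auto
  then have xU: "x \<in> carrier (units_of ?L)"
    using x L.field_Units by (simp add: units_of_carrier)
  interpret G: group "units_of ?L"
    by (rule L.units_group)
  interpret GR: group "units_of R"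
    by (rule units_group)
  have card: "card (carrier ?L) = ?q ^ degree f"
    using card_rupture[OF carrier_is_subfield fin f(1) f0(1)] .
  have q: "?q > 1"
    using card_mono[OF fin, of "{\<zero>, \<one>}"] by simp
  then have finL: "finite (carrier ?L)"
    using card by (intro card_ge_0_finite) simp
  have order: "order (units_of ?L) = ?q ^ degree f - 1"
    using card finL by (simp add: order_def units_of_carrier L.field_Units)
  let ?x = "x [^]\<^bsub>units_of ?L\<^esub> n"
  have xU': "x \<in> Units ?L" and aU: "a \<in> carrier (units_of R)" "a \<in> Units R"
    using xU a by (simp_all add: units_of_carrier field_Units)
  \<comment> \<open>The powers of x^n are the images under \<open>h\<close> of the powers of
    \<open>a\<close>, so both become one at the same exponents. This determines the order of
    x^n.\<close>
  have "?x [^]\<^bsub>units_of ?L\<^esub> j = \<one>\<^bsub>units_of ?L\<^esub> \<longleftrightarrow> ?q - 1 dvd j" for j :: nat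
  proof -
    have "?x [^]\<^bsub>units_of ?L\<^esub> j = x [^]\<^bsub>?L\<^esub> (n * j)"
      unfolding G.nat_pow_pow[OF xU] by (rule L.units_of_pow[OF xU'])
    also have "\<dots> = h (a [^] j)"
      unfolding h.hom_nat_pow[OF a(1)] xn[symmetric] L.nat_pow_pow[OF x] ..
    finally have "?x [^]\<^bsub>units_of ?L\<^esub> j = h (a [^] j)" .
    moreover have "\<one>\<^bsub>units_of ?L\<^esub> = h \<one>"
      by (simp add: units_of_one)
    ultimately have "?x [^]\<^bsub>units_of ?L\<^esub> j = \<one>\<^bsub>units_of ?L\<^esub> \<longleftrightarrow> a [^] j = \<one>"
      using h_inj[of "a [^] j" \<one>] a(1) by simp
    also have "\<dots> \<longleftrightarrow> a [^]\<^bsub>units_of R\<^esub> j = \<one>\<^bsub>units_of R\<^esub>"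
      by (simp add: units_of_pow[OF aU(2)] units_of_one)
    finally show ?thesis
      using GR.pow_eq_id[OF aU(1), of j] ord by simp
  qed
  then have ord_xn: "G.ord ?x = ?q - 1"
    using G.ord_unique[OF G.nat_pow_closed[OF xU], of n "?q - 1"] by blast
  have "finite (carrier (units_of ?L))"
    using finL by (simp add: units_of_carrier L.field_Units)
  then have "G.ord x > 0"
    using G.ord_ge_1[OF _ xU] by simp
  then have "n * (?q - 1) dvd G.ord x"
    using G.mult_ord_pow_dvd_ord[OF xU \<open>n > 0\<close>] primes unfolding ord_xn by blast
  then have "n * (?q - 1) dvd ?q ^ degree f - 1"
    using dvd_trans G.ord_dvd_group_order[OF xU, unfolded order] by blast
  then show ?thesis
    using dvd_of_mult_dvd_power_minus_one[OF \<open>n > 0\<close> q] primes four by blast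
qed

text \<open>In a factorization u v with u not a unit, n divides the degree of an irreducible factor
  of u. Hence deg u = n, and v is a nonzero constant.\<close>

lemma (in field) binomial_poly_irreducible:
  assumes "finite (carrier R)" "a \<in> carrier R" "a \<noteq> \<zero>" and n: "n > 0"
    and "group.ord (units_of R) a = card (carrier R) - 1"
    and "\<And>p. Factorial_Ring.prime p \<Longrightarrow> p dvd n \<Longrightarrow> p dvd card (carrier R) - 1"
    and "4 dvd n \<Longrightarrow> 4 dvd card (carrier R) - 1"
  shows "pirreducible (carrier R) (binomial_poly R n a)"
proof (rule pirreducibleI[OF carrier_is_subring])
  let ?P = "poly_ring R" and ?b = "binomial_poly R n a"
  interpret UP: principal_domain ?P
    using univ_poly_is_principal[OF carrier_is_subfield] .
  show b: "?b \<in> carrier ?P"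
    using binomial_poly_closed[OF assms(2)] .
  show b0: "?b \<noteq> []"
    using binomial_poly_eq[OF assms(2) n] by simp
  have deg: "degree ?b = n"
    using degree_binomial_poly[OF assms(2) n] .
  show "?b \<notin> Units ?P"
    unfolding univ_poly_units'[OF carrier_is_subfield] deg using n by simp
  have *: "v \<in> Units ?P"
    if u: "u \<in> carrier ?P" "u \<notin> Units ?P" and v: "v \<in> carrier ?P" and uv: "?b = u \<otimes>\<^bsub>?P\<^esub> v" for u v
  proof -
    have d: "n = degree u + degree v" "u \<noteq> []" "v \<noteq> []"
      using poly_ring_degree_mult[OF u(1) v, folded uv, OF b0] unfolding deg .
    obtain f where f: "f \<in> carrier ?P" "pirreducible (carrier R) f" "f divides\<^bsub>?P\<^esub> u"
    proof -
      have "u \<in> carrier ?P - {\<zero>\<^bsub>?P\<^esub>}"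
        using u(1) d(2) unfolding univ_poly_zero by blast
      then show ?thesis
        using UP.exists_irreducible_divisor[OF _ u(2)] that by blast
    qed
    have "f divides\<^bsub>?P\<^esub> ?b"
      unfolding uv by (rule UP.divides_prod_r[OF f(3,1) v])
    then have "n dvd degree f"
      using dvd_degree_irreducible_divisor_binomial[OF assms f(1,2)] unfolding pdivides_def by blast
    moreover have "degree f > 0"
      using pirreducible_degree[OF carrier_is_subfield f(1,2)] by simp
    moreover have "degree f \<le> degree u"
    proof -
      obtain r where "r \<in> carrier ?P" "u = f \<otimes>\<^bsub>?P\<^esub> r"
        using f(3) by (rule dividesE)
      then show ?thesis
        using poly_ring_degree_mult(1)[OF f(1), of r] d(2) by simp
    qed
    ultimately have "degree v = 0"
      using d(1) dvd_imp_le[of n "degree f"] by simp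
    then show ?thesis
      using univ_poly_units'[OF carrier_is_subfield, of v] v d(3) by blast
  qed
  fix u v assume "u \<in> carrier ?P" "v \<in> carrier ?P" "?b = u \<otimes>\<^bsub>?P\<^esub> v"
  then show "u \<in> Units ?P \<or> v \<in> Units ?P"
    using * by blast
qed

lemma (in field) not_pirreducible_product:
  assumes "p \<in> carrier (poly_ring R)" "q \<in> carrier (poly_ring R)" "degree p > 0" "degree q > 0"
  shows "\<not> pirreducible (carrier R) (p \<otimes>\<^bsub>poly_ring R\<^esub> q)"
proof -
  interpret UP: domain "poly_ring R"
    using univ_poly_is_domain[OF carrier_is_subring] .
  show ?thesis
    using pirreducibleE(3)[OF carrier_is_subring UP.m_closed[OF assms(1,2)] _ assms(1,2)]
      univ_poly_units'[OF carrier_is_subfield] assms by auto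
qed

section \<open>Reducible binomials\<close>

text \<open>By induction, a cofactor r for k yields the cofactor r x + y^k for k + 1, so no explicit
  sum is needed.\<close>

lemma (in cring) diff_divides_diff_pow:
  assumes "x \<in> carrier R" "y \<in> carrier R"
  shows "(x \<ominus> y) divides (x [^] (k :: nat) \<ominus> y [^] k)"
proof (induction k)
  case 0
  show ?case
    using assms by (intro dividesI[of \<zero>]) (simp_all add: a_minus_def r_neg)
next
  case (Suc k)
  then obtain r where r: "r \<in> carrier R" "x [^] k \<ominus> y [^] k = (x \<ominus> y) \<otimes> r"
    by (rule dividesE)
  have "x [^] k = (x \<ominus> y) \<otimes> r \<oplus> y [^] k"
    unfolding r(2)[symmetric] using assms by (simp add: a_minus_def a_assoc l_neg)
  then have "x [^] Suc k \<ominus> y [^] Suc k = ((x \<ominus> y) \<otimes> r \<oplus> y [^] k) \<otimes> x \<ominus> y [^] k \<otimes> y"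
    by simp
  also have "\<dots> = (x \<ominus> y) \<otimes> (r \<otimes> x \<oplus> y [^] k)"
  proof -
    have "y [^] k \<in> carrier R"
      using assms by simp
    then show ?thesis
      using assms r(1) by algebra
  qed
  finally show ?case
    using assms r(1) by (intro dividesI[of "r \<otimes> x \<oplus> y [^] k"]) simp_all
qed

text \<open>X^m and the constant b are substituted into the divisibility of x^p - y^p by x - y. The
  factor has degree m, and p > 1 leaves a cofactor of positive degree.\<close>

lemma (in field) not_pirreducible_binomial_of_power:
  assumes b: "b \<in> carrier R" and p: "p > 1" and m: "m > 0"
  shows "\<not> pirreducible (carrier R) (binomial_poly R (p * m) (b [^] p))"
proof -
  let ?P = "poly_ring R"
  interpret UP: domain ?P
    using univ_poly_is_domain[OF carrier_is_subring] .
  interpret C: ring_hom_ring "R \<lparr>carrier := carrier R\<rparr>" ?P poly_of_const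
    using canonical_embedding_ring_hom[OF carrier_is_subring] .
  interpret C': ring_hom_ring R ?P poly_of_const
    using C.ring_hom_ring_axioms by simp
  have X: "X \<in> carrier ?P"
    using var_closed(1)[OF carrier_is_subring] .
  have cb: "poly_of_const b \<in> carrier ?P"
    using b by simp
  have "binomial_poly R (p * m) (b [^] p)
      = (X [^]\<^bsub>?P\<^esub> m) [^]\<^bsub>?P\<^esub> p \<ominus>\<^bsub>?P\<^esub> poly_of_const b [^]\<^bsub>?P\<^esub> p"
    unfolding binomial_poly_def C'.hom_nat_pow[OF b] UP.nat_pow_pow[OF X] mult.commute[of m] ..
  moreover have "binomial_poly R m b = X [^]\<^bsub>?P\<^esub> m \<ominus>\<^bsub>?P\<^esub> poly_of_const b"
    unfolding binomial_poly_def ..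
  ultimately have "binomial_poly R m b divides\<^bsub>?P\<^esub> binomial_poly R (p * m) (b [^] p)"
    using UP.diff_divides_diff_pow[OF UP.nat_pow_closed[OF X] cb] by metis
  then obtain r where r: "r \<in> carrier ?P"
    "binomial_poly R (p * m) (b [^] p) = binomial_poly R m b \<otimes>\<^bsub>?P\<^esub> r"
    by (rule dividesE)
  have bp: "b [^] p \<in> carrier R" and pm: "p * m > 0"
    using b p m by simp_all
  have "binomial_poly R (p * m) (b [^] p) \<noteq> []"
    by (simp add: binomial_poly_eq[OF bp pm])
  then have "p * m = m + degree r"
    using poly_ring_degree_mult(1)[OF binomial_poly_closed[OF b, of m] r(1), folded r(2)]
    unfolding degree_binomial_poly[OF b m] degree_binomial_poly[OF bp pm] by blast
  moreover have "p * m > m"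
    using p m by simp
  ultimately have "degree r > 0"
    by linarith
  then show ?thesis
    using not_pirreducible_product[OF binomial_poly_closed[OF b] r(1)]
      degree_binomial_poly[OF b m] m unfolding r(2) by simp
qed

text \<open>The product is (y^2 + e)^2 - d^2 y^2, and d^2 = 2 e cancels the cross term, leaving y^4
  + e^2. Using d and e avoids dividing by 2; the double minus matches the binomial with constant
  -e^2.\<close>

lemma (in cring) sophie_germain:
  assumes "y \<in> carrier R" "d \<in> carrier R" "e \<in> carrier R" and de: "e \<oplus> e = d \<otimes> d"
  shows "(y \<otimes> y \<oplus> e \<oplus> d \<otimes> y) \<otimes> (y \<otimes> y \<oplus> e \<ominus> d \<otimes> y)
    = y \<otimes> y \<otimes> (y \<otimes> y) \<ominus> \<ominus> (e \<otimes> e)"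
proof -
  have "(y \<otimes> y \<oplus> e \<oplus> d \<otimes> y) \<otimes> (y \<otimes> y \<oplus> e \<ominus> d \<otimes> y)
      = (y \<otimes> y \<oplus> e) \<otimes> (y \<otimes> y \<oplus> e) \<ominus> d \<otimes> d \<otimes> (y \<otimes> y)"
    using assms(1-3) by algebra
  also have "\<dots> = (y \<otimes> y \<oplus> e) \<otimes> (y \<otimes> y \<oplus> e) \<ominus> (e \<oplus> e) \<otimes> (y \<otimes> y)"
    unfolding de ..
  also have "\<dots> = y \<otimes> y \<otimes> (y \<otimes> y) \<ominus> \<ominus> (e \<otimes> e)"
    using assms(1-3) by algebra
  finally show ?thesis .
qed

text \<open>Outside characteristic 2 the elements \<open>-e^2\<close> with \<open>2 e = d^2\<close> are the \<open>-4 h^4\<close>, with \<open>d = 2 h\<close>.\<close>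

lemma (in field) not_pirreducible_binomial_of_minus_four_fourth_power:
  assumes d: "d \<in> carrier R" and e: "e \<in> carrier R" and de: "e \<oplus> e = d \<otimes> d" and m: "m > 0"
  shows "\<not> pirreducible (carrier R) (binomial_poly R (4 * m) (\<ominus> (e \<otimes> e)))"
proof -
  let ?P = "poly_ring R"
  interpret UP: domain ?P
    using univ_poly_is_domain[OF carrier_is_subring] .
  interpret C: ring_hom_ring "R \<lparr>carrier := carrier R\<rparr>" ?P poly_of_const
    using canonical_embedding_ring_hom[OF carrier_is_subring] .
  interpret C': ring_hom_ring R ?P poly_of_const
    using C.ring_hom_ring_axioms by simp
  define Y where "Y = X [^]\<^bsub>?P\<^esub> m"
  define D where "D = poly_of_const d"
  define E where "E = poly_of_const e"
  have X: "X \<in> carrier ?P"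
    using var_closed(1)[OF carrier_is_subring] .
  have Y: "Y \<in> carrier ?P" and D: "D \<in> carrier ?P" and E: "E \<in> carrier ?P"
    using X d e by (simp_all add: Y_def D_def E_def)
  have degY: "degree Y = m"
    unfolding Y_def unitary_monom_eq_var_pow[OF carrier_is_subring, symmetric] by (simp add: monom_def)
  have degC: "degree D = 0" "degree E = 0"
    using normalize_length_le[of "[d]"] normalize_length_le[of "[e]"]
    by (simp_all add: D_def E_def poly_of_const_def)
  have deg_add: "degree (p \<oplus>\<^bsub>?P\<^esub> q) \<le> 2 * m" if "degree p \<le> 2 * m" "degree q \<le> 2 * m" for p q
    using poly_add_degree[of p q] that unfolding univ_poly_add by linarith
  have deg_mult: "degree (p \<otimes>\<^bsub>?P\<^esub> q) \<le> degree p + degree q"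
    if "p \<in> carrier ?P" "q \<in> carrier ?P" for p q
    using poly_ring_degree_mult(1)[OF that] by (cases "p \<otimes>\<^bsub>?P\<^esub> q = []") simp_all
  let ?a = "Y \<otimes>\<^bsub>?P\<^esub> Y \<oplus>\<^bsub>?P\<^esub> E \<oplus>\<^bsub>?P\<^esub> D \<otimes>\<^bsub>?P\<^esub> Y"
    and ?b = "Y \<otimes>\<^bsub>?P\<^esub> Y \<oplus>\<^bsub>?P\<^esub> E \<ominus>\<^bsub>?P\<^esub> D \<otimes>\<^bsub>?P\<^esub> Y"
  have ab: "?a \<in> carrier ?P" "?b \<in> carrier ?P"
    using Y D E by simp_all
  have YY: "degree (Y \<otimes>\<^bsub>?P\<^esub> Y \<oplus>\<^bsub>?P\<^esub> E) \<le> 2 * m"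
    using deg_mult[OF Y Y] degY degC by (intro deg_add) simp_all
  have DY: "degree (D \<otimes>\<^bsub>?P\<^esub> Y) \<le> 2 * m"
    using deg_mult[OF D Y] degY degC by simp
  \<comment> \<open>Upper bounds suffice: the degrees of the two factors add up to 4 m, so bounds of
    2 m force equality and neither factor is constant.\<close>
  have "degree ?a \<le> 2 * m"
    using YY DY by (rule deg_add)
  moreover have "degree (\<ominus>\<^bsub>?P\<^esub> (D \<otimes>\<^bsub>?P\<^esub> Y)) \<le> 2 * m"
    using DY univ_poly_a_inv_degree[OF carrier_is_subring UP.m_closed[OF D Y]] by simp
  then have "degree ?b \<le> 2 * m"
    unfolding a_minus_def by (rule deg_add[OF YY])
  moreover have prod: "binomial_poly R (4 * m) (\<ominus> (e \<otimes> e)) = ?a \<otimes>\<^bsub>?P\<^esub> ?b"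
  proof -
    have "E \<oplus>\<^bsub>?P\<^esub> E = D \<otimes>\<^bsub>?P\<^esub> D"
      using C'.hom_add[OF e e] C'.hom_mult[OF d d] de unfolding D_def E_def by simp
    then have "?a \<otimes>\<^bsub>?P\<^esub> ?b = Y \<otimes>\<^bsub>?P\<^esub> Y \<otimes>\<^bsub>?P\<^esub> (Y \<otimes>\<^bsub>?P\<^esub> Y) \<ominus>\<^bsub>?P\<^esub> \<ominus>\<^bsub>?P\<^esub> (E \<otimes>\<^bsub>?P\<^esub> E)"
      by (rule UP.sophie_germain[OF Y D E])
    moreover have "Y \<otimes>\<^bsub>?P\<^esub> Y \<otimes>\<^bsub>?P\<^esub> (Y \<otimes>\<^bsub>?P\<^esub> Y) = X [^]\<^bsub>?P\<^esub> (4 * m)"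
      unfolding Y_def UP.nat_pow_mult[OF X] by (rule arg_cong[where f = "([^]\<^bsub>?P\<^esub>) X"]) simp
    moreover have "\<ominus>\<^bsub>?P\<^esub> (E \<otimes>\<^bsub>?P\<^esub> E) = poly_of_const (\<ominus> (e \<otimes> e))"
      unfolding E_def C'.hom_a_inv[OF m_closed[OF e e]] C'.hom_mult[OF e e] ..
    ultimately show ?thesis
      unfolding binomial_poly_def by simp
  qed
  moreover have "degree ?a + degree ?b = 4 * m"
  proof -
    have ee: "\<ominus> (e \<otimes> e) \<in> carrier R" and m4: "4 * m > 0"
      using e m by simp_all
    show ?thesis
      using poly_ring_degree_mult(1)[OF ab, folded prod]
        degree_binomial_poly[OF ee m4] binomial_poly_eq[OF ee m4] by simp
  qed
  ultimately show ?thesis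
    using not_pirreducible_product[OF ab] m unfolding prod by linarith
qed

text \<open>If a = e^2, the power case applies with exponent 2. Otherwise a = -e^2; one of 2 e, -2 e
  is a square, so after replacing e by -e if necessary 2 e = d^2, and the binomial factors by Sophie
  Germain's identity.\<close>

lemma (in field) not_pirreducible_binomial_of_four_dvd:
  assumes sq: "\<And>x. x \<in> carrier R \<Longrightarrow> \<exists>y\<in>carrier R. x = y \<otimes> y \<or> \<ominus> x = y \<otimes> y"
    and a: "a \<in> carrier R" and "n > 0" "4 dvd n"
  shows "\<not> pirreducible (carrier R) (binomial_poly R n a)"
proof -
  obtain m where n: "n = 4 * m" "m > 0"
    using assms(3,4) by (auto elim: dvdE)
  obtain e where e: "e \<in> carrier R" "a = e \<otimes> e \<or> \<ominus> a = e \<otimes> e"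
    using sq[OF a] by blast
  then consider "a = e \<otimes> e" | "\<ominus> a = e \<otimes> e"
    by blast
  then show ?thesis
  proof cases
    case 1
    then have "a = e [^] (2 :: nat)"
      using e(1) by (simp add: numeral_2_eq_2)
    then show ?thesis
      using not_pirreducible_binomial_of_power[OF e(1), of 2 "2 * m"] n by simp
  next
    case 2
    then have a_eq: "a = \<ominus> (e \<otimes> e)"
      using a by (metis minus_minus)
    obtain d where d: "d \<in> carrier R" "e \<oplus> e = d \<otimes> d \<or> \<ominus> (e \<oplus> e) = d \<otimes> d"
      using sq[of "e \<oplus> e"] e(1) by auto
    have "\<ominus> (e \<oplus> e) = \<ominus> e \<oplus> \<ominus> e" "\<ominus> e \<otimes> \<ominus> e = e \<otimes> e"
      using e(1) by (simp_all add: minus_add l_minus r_minus)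
    then obtain e' where e': "e' \<in> carrier R" "e' \<oplus> e' = d \<otimes> d" "e \<otimes> e = e' \<otimes> e'"
      using d(2) e(1) a_inv_closed by metis
    show ?thesis
      unfolding n(1) a_eq e'(3)
      by (rule not_pirreducible_binomial_of_minus_four_fourth_power[OF d(1) e'(1,2) n(2)])
  qed
qed

section \<open>Powers and squares in finite fields\<close>

lemma (in field) finite_field_pow_card:
  assumes "finite (carrier R)" "x \<in> carrier R" "x \<noteq> \<zero>"
  shows "x [^] (card (carrier R) - 1) = \<one>"
proof -
  interpret G: group "units_of R"
    by (rule units_group)
  have x: "x \<in> Units R"
    using assms by (simp add: field_Units)
  have "order (units_of R) = card (carrier R) - 1"
    using assms(1) by (simp add: order_def units_of_carrier field_Units)
  then show ?thesis
    using G.pow_order_eq_1[of x] x by (simp add: units_of_carrier units_of_pow units_of_one)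
qed

lemma (in field) finite_field_pow_surj:
  assumes fin: "finite (carrier R)" and cop: "coprime p (card (carrier R) - 1)" and "p > 0"
    and x: "x \<in> carrier R"
  shows "\<exists>y\<in>carrier R. x = y [^] p"
proof (cases "x = \<zero>")
  case True
  then show ?thesis
    using nat_pow_zero[of p] \<open>p > 0\<close> by (intro bexI[of _ \<zero>]) simp_all
next
  case False
  let ?N = "card (carrier R) - 1"
  \<comment> \<open>Bezout for the coprime numbers \<open>p\<close> and \<open>?N\<close>: since x^N
    = 1, x = x^(N t + 1) = (x^s)^p.\<close>
  obtain s t where "p * s = ?N * t + 1"
    using bezout_nat[of p ?N] cop \<open>p > 0\<close> by (auto simp: coprime_iff_gcd_eq_1)
  then have "x = (x [^] s) [^] p"
    using x finite_field_pow_card[OF fin x False]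
    by (simp add: nat_pow_pow mult.commute[of s] flip: nat_pow_mult)
      (simp flip: nat_pow_pow)
  then show ?thesis
    using x by blast
qed

text \<open>Let q be the size of the field. If q - 1 is odd, squaring is onto. Otherwise q - 1 = 2 M
  with M odd; for nonzero x, x^M is 1 or -1, and x^(M + 1), which is x or -x, is the square of x^((M
  + 1) / 2).\<close>

lemma (in field) finite_field_square_or_minus_square:
  assumes fin: "finite (carrier R)" and "\<not> 4 dvd card (carrier R) - 1"
    and x: "x \<in> carrier R"
  shows "\<exists>y\<in>carrier R. x = y \<otimes> y \<or> \<ominus> x = y \<otimes> y"
proof (cases "even (card (carrier R) - 1)")
  case False
  then have "\<exists>y\<in>carrier R. x = y [^] (2 :: nat)"
    using finite_field_pow_surj[OF fin _ _ x, of 2] by simp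
  then show ?thesis
    by (auto simp: numeral_2_eq_2)
next
  case True
  then obtain M where M: "card (carrier R) - 1 = 2 * M"
    by blast
  then have "odd M"
    using assms(2) by auto
  then obtain k where k: "M + 1 = k + k"
    by (metis add.commute even_plus_one_iff evenE mult_2)
  show ?thesis
  proof (cases "x = \<zero>")
    case False
    have xM: "x [^] M \<in> carrier R"
      using x by simp
    have "x [^] M \<otimes> x [^] M = \<one>"
      using finite_field_pow_card[OF fin x False] M x by (simp add: nat_pow_mult mult_2)
    then have "x [^] M = \<one> \<or> x [^] M = \<ominus> \<one>"
      using square_eq_one[OF xM] by blast
    moreover have "x [^] M \<otimes> x = x [^] k \<otimes> x [^] k"
      using x k by (simp add: nat_pow_mult flip: nat_pow_Suc)
    ultimately have "x = x [^] k \<otimes> x [^] k \<or> \<ominus> x = x [^] k \<otimes> x [^] k"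
      using x by (auto simp: l_minus)
    then show ?thesis
      using x by blast
  qed (intro bexI[of _ \<zero>], simp_all)
qed

section \<open>Ultraproducts of fields\<close>

locale field_ultraproduct =
  fixes U :: "'i filter" and F :: "'i \<Rightarrow> ('a, 'b) ring_scheme"
  assumes ultra: "ultrafilter U" and fields: "\<And>i. field (F i)"
begin

abbreviation P where "P \<equiv> product_ring F"
abbreviation K where "K \<equiv> ultraproduct U F"
abbreviation cls where "cls \<equiv> ultra_class U F"

lemma crings: "cring (F i)"
  using fields by (rule fieldE(1))

lemma not_bot: "U \<noteq> bot"
  using ultra by (simp add: ultrafilter_def)

text \<open>The negation clause of Los's theorem: maximality of the ultrafilter gives one direction,
  properness the other.\<close>

lemma not_eventually_iff: "\<not> eventually A U \<longleftrightarrow> eventually (\<lambda>i. \<not> A i) U"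
proof
  assume "\<not> eventually A U"
  then show "eventually (\<lambda>i. \<not> A i) U"
    using ultra unfolding ultrafilter_def by blast
next
  assume "eventually (\<lambda>i. \<not> A i) U"
  then show "\<not> eventually A U"
    using eventually_happens'[OF not_bot] eventually_conj by fastforce
qed

lemma eventually_disj_iff: "eventually (\<lambda>i. A i \<or> B i) U \<longleftrightarrow> eventually A U \<or> eventually B U"
proof -
  have "\<not> eventually (\<lambda>i. A i \<or> B i) U \<longleftrightarrow> \<not> (eventually A U \<or> eventually B U)"
    unfolding de_Morgan_disj not_eventually_iff by (simp add: eventually_conj_iff)
  then show ?thesis by blast
qed

lemma product_carrier: "f \<in> carrier P \<longleftrightarrow> (\<forall>i. f i \<in> carrier (F i))"
  by (simp add: product_ring_def Pi_iff)

sublocale P: cring P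
  by (rule product_ring_cring[OF crings])

sublocale I: ideal "ultra_ideal U F" P
  by (rule ultra_ideal[OF crings])

lemma cls_hom: "ring_hom_ring P K cls"
  using I.rcos_ring_hom_ring unfolding ultraproduct_def ultra_class_def .

lemma eval_hom: "ring_hom_ring P (F i) (\<lambda>f. f i)"
proof (rule ring_hom_ringI2[OF P.ring_axioms])
  show "ring (F i)"
    using crings[of i] by (rule cring.axioms(1))
  show "(\<lambda>f. f i) \<in> ring_hom P (F i)"
    by (rule ring_hom_memI) (auto simp: product_ring_def)
qed

lemma product_pow:
  assumes "f \<in> carrier P"
  shows "(f [^]\<^bsub>P\<^esub> (k :: nat)) i = f i [^]\<^bsub>F i\<^esub> k"
proof -
  interpret ev: ring_hom_ring P "F i" "\<lambda>f. f i"
    by (rule eval_hom)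
  show ?thesis
    using ev.hom_nat_pow[OF assms] .
qed

lemma product_mult: "(f \<otimes>\<^bsub>P\<^esub> g) i = f i \<otimes>\<^bsub>F i\<^esub> g i"
  by (simp add: product_ring_def)

lemma product_minus: "f \<in> carrier P \<Longrightarrow> (\<ominus>\<^bsub>P\<^esub> f) i = \<ominus>\<^bsub>F i\<^esub> f i"
  by (simp add: product_ring_minus[OF crings])

text \<open>The atomic case of Los's theorem, through which every transfer below passes.\<close>

lemma cls_eq_iff:
  assumes "f \<in> carrier P" "g \<in> carrier P"
  shows "cls f = cls g \<longleftrightarrow> eventually (\<lambda>i. f i = g i) U"
proof
  assume "cls f = cls g"
  then have "ultra_rel U F `` {f} = ultra_rel U F `` {g}"
    using assms by (simp add: ultra_class_eq_Image[OF crings])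
  moreover have "g \<in> ultra_rel U F `` {g}"
    using assms by (simp add: ultra_rel_def)
  ultimately have "g \<in> ultra_rel U F `` {f}"
    by blast
  then show "eventually (\<lambda>i. f i = g i) U"
    by (simp add: ultra_rel_def)
next
  assume e: "eventually (\<lambda>i. f i = g i) U"
  have "eventually (\<lambda>i. f i = h i) U \<longleftrightarrow> eventually (\<lambda>i. g i = h i) U" for h
    by (rule eventually_cong[OF e]) simp
  then have "ultra_rel U F `` {f} = ultra_rel U F `` {g}"
    using assms by (auto simp: ultra_rel_def)
  then show "cls f = cls g"
    using assms by (simp add: ultra_class_eq_Image[OF crings])
qed

lemma cls_surj:
  assumes "a \<in> carrier K"
  obtains f where "f \<in> carrier P" "a = cls f"
proof -
  have "carrier K = cls ` carrier P"
    by (auto simp: ultraproduct_def FactRing_def A_RCOSETS_def RCOSETS_def ultra_class_def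
        a_r_coset_def)
  then show ?thesis
    using assms that by blast
qed

text \<open>A nonzero class is represented by a sequence that is nonzero on a set of the
  ultrafilter, and there it can be inverted pointwise.\<close>

lemma field_K: "field K"
proof -
  interpret K: cring K
    unfolding ultraproduct_def by (rule I.quotient_is_cring[OF P.cring_axioms])
  interpret cls: ring_hom_ring P K cls
    by (rule cls_hom)
  have zero: "\<zero>\<^bsub>P\<^esub> i = \<zero>\<^bsub>F i\<^esub>" and one: "\<one>\<^bsub>P\<^esub> i = \<one>\<^bsub>F i\<^esub>" for i
    by (simp_all add: product_ring_def)
  have "\<zero>\<^bsub>K\<^esub> \<noteq> \<one>\<^bsub>K\<^esub>"
  proof
    assume "\<zero>\<^bsub>K\<^esub> = \<one>\<^bsub>K\<^esub>"
    then have "cls \<zero>\<^bsub>P\<^esub> = cls \<one>\<^bsub>P\<^esub>"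
      unfolding cls.hom_zero cls.hom_one .
    then have "eventually (\<lambda>i. \<zero>\<^bsub>F i\<^esub> = \<one>\<^bsub>F i\<^esub>) U"
      unfolding cls_eq_iff[OF P.zero_closed P.one_closed] zero one .
    then obtain i where "\<zero>\<^bsub>F i\<^esub> = \<one>\<^bsub>F i\<^esub>"
      using eventually_happens'[OF not_bot] by blast
    then show False
      using domain.one_not_zero[OF field.axioms(1)[OF fields[of i]]] by simp
  qed
  moreover have "\<exists>b\<in>carrier K. a \<otimes>\<^bsub>K\<^esub> b = \<one>\<^bsub>K\<^esub>" if a: "a \<in> carrier K" "a \<noteq> \<zero>\<^bsub>K\<^esub>" for a
  proof -
    obtain f where f: "f \<in> carrier P" "a = cls f"
      using a(1) by (rule cls_surj)
    have "\<not> eventually (\<lambda>i. f i = \<zero>\<^bsub>F i\<^esub>) U"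
      using a(2) unfolding f(2) cls.hom_zero[symmetric] cls_eq_iff[OF f(1) P.zero_closed] zero .
    then have ev: "eventually (\<lambda>i. f i \<noteq> \<zero>\<^bsub>F i\<^esub>) U"
      by (simp add: not_eventually_iff)
    \<comment> \<open>The value zero where \<open>f i\<close> vanishes only keeps \<open>g\<close>
      in the product; it does not affect the class.\<close>
    define g where "g i = (if f i = \<zero>\<^bsub>F i\<^esub> then \<zero>\<^bsub>F i\<^esub> else inv\<^bsub>F i\<^esub> f i)" for i
    have inv: "inv\<^bsub>F i\<^esub> f i \<in> carrier (F i)" "f i \<otimes>\<^bsub>F i\<^esub> inv\<^bsub>F i\<^esub> f i = \<one>\<^bsub>F i\<^esub>"
      if "f i \<noteq> \<zero>\<^bsub>F i\<^esub>" for i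
    proof -
      interpret field "F i"
        by (rule fields)
      have "f i \<in> Units (F i)"
        using f(1) that by (simp add: product_carrier field_Units)
      then show "inv\<^bsub>F i\<^esub> f i \<in> carrier (F i)" "f i \<otimes>\<^bsub>F i\<^esub> inv\<^bsub>F i\<^esub> f i = \<one>\<^bsub>F i\<^esub>"
        by simp_all
    qed
    have g: "g \<in> carrier P"
      using inv(1) crings by (simp add: g_def product_carrier cring.cring_simprules)
    have "eventually (\<lambda>i. (f \<otimes>\<^bsub>P\<^esub> g) i = \<one>\<^bsub>P\<^esub> i) U"
      using ev by (rule eventually_mono) (simp add: product_mult g_def inv one)
    then have "cls f \<otimes>\<^bsub>K\<^esub> cls g = \<one>\<^bsub>K\<^esub>"
      unfolding cls_eq_iff[OF P.m_closed[OF f(1) g] P.one_closed, symmetric]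
        cls.hom_mult[OF f(1) g] cls.hom_one .
    then show ?thesis
      unfolding f(2) using cls.hom_closed[OF g] by blast
  qed
  ultimately show ?thesis
    by (rule K.cring_fieldI2)
qed

section \<open>Transfer from the factors to the ultraproduct\<close>

lemma pow_surj_transfer:
  assumes "eventually (\<lambda>i. \<forall>x\<in>carrier (F i). \<exists>y\<in>carrier (F i). x = y [^]\<^bsub>F i\<^esub> k) U"
    and a: "a \<in> carrier K"
  shows "\<exists>b\<in>carrier K. a = b [^]\<^bsub>K\<^esub> (k :: nat)"
proof -
  interpret cls: ring_hom_ring P K cls
    by (rule cls_hom)
  obtain f where f: "f \<in> carrier P" "a = cls f"
    using a by (rule cls_surj)
  \<comment> \<open>The choice stays in the carrier at every index and is a k-th root of
    \<open>f i\<close> wherever one exists; elsewhere any element serves, such as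
    \<open>f i\<close>.\<close>
  have "\<forall>i. \<exists>y\<in>carrier (F i). (\<exists>y\<in>carrier (F i). f i = y [^]\<^bsub>F i\<^esub> k) \<longrightarrow> f i = y [^]\<^bsub>F i\<^esub> k"
    using f(1) unfolding product_carrier by blast
  then obtain g where g: "\<And>i. g i \<in> carrier (F i)"
    "\<And>i. (\<exists>y\<in>carrier (F i). f i = y [^]\<^bsub>F i\<^esub> k) \<Longrightarrow> f i = g i [^]\<^bsub>F i\<^esub> k"
    by metis
  have gP: "g \<in> carrier P"
    using g(1) by (simp add: product_carrier)
  have "eventually (\<lambda>i. f i = (g [^]\<^bsub>P\<^esub> k) i) U"
    using assms(1) by (rule eventually_mono) (use f(1) g(2) in \<open>simp add: product_pow[OF gP] product_carrier\<close>)
  then have "a = cls g [^]\<^bsub>K\<^esub> k"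
    using cls_eq_iff[OF f(1) P.nat_pow_closed[OF gP]] f(2) cls.hom_nat_pow[OF gP] by metis
  then show ?thesis
    using cls.hom_closed[OF gP] by blast
qed

text \<open>Which alternative holds may vary with the index, but one of the two must hold on a set
  of the ultrafilter.\<close>

lemma square_or_minus_square_transfer:
  assumes "eventually (\<lambda>i. \<forall>x\<in>carrier (F i). \<exists>y\<in>carrier (F i).
      x = y \<otimes>\<^bsub>F i\<^esub> y \<or> \<ominus>\<^bsub>F i\<^esub> x = y \<otimes>\<^bsub>F i\<^esub> y) U"
    and a: "a \<in> carrier K"
  shows "\<exists>b\<in>carrier K. a = b \<otimes>\<^bsub>K\<^esub> b \<or> \<ominus>\<^bsub>K\<^esub> a = b \<otimes>\<^bsub>K\<^esub> b"
proof -
  interpret cls: ring_hom_ring P K cls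
    by (rule cls_hom)
  obtain f where f: "f \<in> carrier P" "a = cls f"
    using a by (rule cls_surj)
  let ?Q = "\<lambda>i y. f i = y \<otimes>\<^bsub>F i\<^esub> y \<or> \<ominus>\<^bsub>F i\<^esub> f i = y \<otimes>\<^bsub>F i\<^esub> y"
  have "\<forall>i. \<exists>y\<in>carrier (F i). (\<exists>y\<in>carrier (F i). ?Q i y) \<longrightarrow> ?Q i y"
    using f(1) unfolding product_carrier by blast
  then obtain g where g: "\<And>i. g i \<in> carrier (F i)"
    "\<And>i. (\<exists>y\<in>carrier (F i). ?Q i y) \<Longrightarrow> ?Q i (g i)"
    by metis
  have gP: "g \<in> carrier P"
    using g(1) by (simp add: product_carrier)
  have "eventually (\<lambda>i. f i = (g \<otimes>\<^bsub>P\<^esub> g) i \<or> (\<ominus>\<^bsub>P\<^esub> f) i = (g \<otimes>\<^bsub>P\<^esub> g) i) U"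
    using assms(1) unfolding product_mult product_minus[OF f(1)]
    by (rule eventually_mono) (use f(1) g(2) in \<open>simp add: product_carrier\<close>)
  then have "cls f = cls (g \<otimes>\<^bsub>P\<^esub> g) \<or> cls (\<ominus>\<^bsub>P\<^esub> f) = cls (g \<otimes>\<^bsub>P\<^esub> g)"
    unfolding eventually_disj_iff cls_eq_iff[OF f(1) P.m_closed[OF gP gP]]
      cls_eq_iff[OF P.a_inv_closed[OF f(1)] P.m_closed[OF gP gP]] .
  then have "a = cls g \<otimes>\<^bsub>K\<^esub> cls g \<or> \<ominus>\<^bsub>K\<^esub> a = cls g \<otimes>\<^bsub>K\<^esub> cls g"
    unfolding f(2) cls.hom_mult[OF gP gP] cls.hom_a_inv[OF f(1)] .
  then show ?thesis
    using cls.hom_closed[OF gP] by blast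
qed

text \<open>The coefficients of two nonconstant factors over \<open>K\<close> lift to sequences.
  Finitely many coefficient identities and the nonvanishing of both leading coefficients hold
  together at some index where the binomial is irreducible, and evaluation there gives a forbidden
  factorization.\<close>

lemma binomial_poly_irreducible_transfer:
  assumes g: "g \<in> carrier P" and n: "n > 0"
    and irr: "eventually (\<lambda>i. pirreducible\<^bsub>F i\<^esub> (carrier (F i)) (binomial_poly (F i) n (g i))) U"
  shows "pirreducible\<^bsub>K\<^esub> (carrier K) (binomial_poly K n (cls g))"
proof -
  interpret K: field K
    by (rule field_K)
  interpret cls: ring_hom_ring P K cls
    by (rule cls_hom)
  let ?R = "poly_ring K" and ?b = "binomial_poly K n (cls g)"
  \<comment> \<open>\<open>C\<close> lifts the coefficients of the binomial to \<open>P\<close>, so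
    that \<open>cls\<close> and the projection to any factor can be applied to one and the same
    list.\<close>
  define C where "C = \<one>\<^bsub>P\<^esub> # replicate (n - 1) \<zero>\<^bsub>P\<^esub> @ [\<ominus>\<^bsub>P\<^esub> g]"
  have C: "set C \<subseteq> carrier P"
    using g by (auto simp: C_def)
  have cg: "cls g \<in> carrier K"
    using g by simp
  have b_eq: "?b = map cls C"
    using g by (simp add: K.binomial_poly_eq[OF cg n] C_def)
  have b: "?b \<in> carrier ?R" "degree ?b = n"
    using K.binomial_poly_closed[OF cg] K.degree_binomial_poly[OF cg n] by blast+
  have b0: "?b \<noteq> []"
    by (simp add: K.binomial_poly_eq[OF cg n])
  have no_factors: False
    if a: "a \<in> carrier ?R" "degree a > 0" and c: "c \<in> carrier ?R" "degree c > 0"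
      and ac: "?b = a \<otimes>\<^bsub>?R\<^esub> c" for a c
  proof -
    have lift: "\<exists>A. set A \<subseteq> carrier P \<and> map cls A = p" if "p \<in> carrier ?R" for p
    proof -
      have "set p \<subseteq> carrier K"
        using that K.polynomial_in_carrier[OF K.carrier_is_subring] by (simp add: univ_poly_carrier)
      then have "\<forall>x\<in>set p. \<exists>f. f \<in> carrier P \<and> cls f = x"
        using cls_surj by (metis subsetD)
      then obtain r where r: "\<forall>x\<in>set p. r x \<in> carrier P \<and> cls (r x) = x"
        by metis
      then show ?thesis
        by (intro exI[of _ "map r p"]) (auto intro: map_idI)
    qed
    obtain A where A: "set A \<subseteq> carrier P" "map cls A = a"
      using lift[OF a(1)] by blast
    obtain B where B: "set B \<subseteq> carrier P" "map cls B = c"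
      using lift[OF c(1)] by blast
    define D where "D = P.poly_mult A B"
    have D: "set D \<subseteq> carrier P"
      unfolding D_def by (rule P.poly_mult_in_carrier[OF A(1) B(1)])
    have "K.normalize (map cls D) = map cls C"
      unfolding D_def cls.poly_mult_hom'[OF A(1) B(1)] A(2) B(2) b_eq[symmetric] ac univ_poly_mult ..
    then have "cls (P.coeff D j) = cls (P.coeff C j)" for j
      unfolding cls.coeff_hom'[OF D] cls.coeff_hom'[OF C] by (metis K.normalize_coeff)
    then have "eventually (\<lambda>i. P.coeff D j i = P.coeff C j i) U" for j
      using cls_eq_iff P.coeff_in_carrier C D by simp
    \<comment> \<open>Filters are closed under finite intersections, so j is bounded; beyond both
      lengths all coefficients are zero.\<close>
    then have "eventually (\<lambda>i. \<forall>j<max (length D) (length C). P.coeff D j i = P.coeff C j i) U"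
      by (simp add: eventually_ball_finite_distrib flip: Ball_def lessThan_iff)
    \<comment> \<open>Nonzero leading entries at index i make the evaluated lists polynomials of the
      same degrees as over \<open>K\<close>.\<close>
    moreover have lead: "eventually (\<lambda>i. hd E i \<noteq> \<zero>\<^bsub>F i\<^esub>) U"
      if E: "set E \<subseteq> carrier P" "map cls E \<in> carrier ?R" "degree (map cls E) > 0" for E
    proof -
      have E0: "E \<noteq> []"
        using E(3) by auto
      then have "cls (hd E) \<noteq> \<zero>\<^bsub>K\<^esub>"
        using E(2) unfolding univ_poly_carrier[symmetric] polynomial_def by (simp add: hd_map)
      moreover have "hd E \<in> carrier P"
        using E0 E(1) by auto
      ultimately have "\<not> eventually (\<lambda>i. hd E i = \<zero>\<^bsub>P\<^esub> i) U"
        using cls_eq_iff[OF _ P.zero_closed] cls.hom_zero by metis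
      then show ?thesis
        by (simp add: not_eventually_iff) (simp add: product_ring_def)
    qed
    have "eventually (\<lambda>i. hd A i \<noteq> \<zero>\<^bsub>F i\<^esub>) U"
      using lead[OF A(1)] a unfolding A(2) by blast
    moreover have "eventually (\<lambda>i. hd B i \<noteq> \<zero>\<^bsub>F i\<^esub>) U"
      using lead[OF B(1)] c unfolding B(2) by blast
    ultimately have "eventually (\<lambda>i. (\<forall>j<max (length D) (length C). P.coeff D j i = P.coeff C j i)
        \<and> hd A i \<noteq> \<zero>\<^bsub>F i\<^esub> \<and> hd B i \<noteq> \<zero>\<^bsub>F i\<^esub>
        \<and> pirreducible\<^bsub>F i\<^esub> (carrier (F i)) (binomial_poly (F i) n (g i))) U"
      using irr by (simp add: eventually_conj_iff)
    then obtain i where i: "\<And>j. j < max (length D) (length C) \<Longrightarrow> P.coeff D j i = P.coeff C j i"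
      "hd A i \<noteq> \<zero>\<^bsub>F i\<^esub>" "hd B i \<noteq> \<zero>\<^bsub>F i\<^esub>"
      "pirreducible\<^bsub>F i\<^esub> (carrier (F i)) (binomial_poly (F i) n (g i))"
      using eventually_happens'[OF not_bot] by blast
    interpret Fi: field "F i"
      by (rule fields)
    interpret ev: ring_hom_ring P "F i" "\<lambda>f. f i"
      by (rule eval_hom)
    let ?ev = "map (\<lambda>f. f i)"
    have carr: "set (?ev E) \<subseteq> carrier (F i)" if "set E \<subseteq> carrier P" for E
      using that by (auto simp: product_carrier)
    have "P.coeff D j i = P.coeff C j i" for j
      using i(1)[of j] P.coeff_length[of D j] P.coeff_length[of C j]
      by (cases "j < max (length D) (length C)") auto
    \<comment> \<open>Lists with the same coefficients agree up to leading zeros, hence agree after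
      \<open>normalize\<close>.\<close>
    then have "Fi.coeff (Fi.normalize (?ev D)) = Fi.coeff (Fi.normalize (?ev C))"
      unfolding Fi.normalize_coeff[symmetric] using ev.coeff_hom'[OF D] ev.coeff_hom'[OF C] by auto
    then have DC: "Fi.normalize (?ev D) = Fi.normalize (?ev C)"
      using Fi.coeff_iff_polynomial_cond[OF Fi.normalize_gives_polynomial[OF carr[OF D]]
          Fi.normalize_gives_polynomial[OF carr[OF C]]] by blast
    have gi: "g i \<in> carrier (F i)"
      using g by (simp add: product_carrier)
    have "?ev C = binomial_poly (F i) n (g i)"
      unfolding Fi.binomial_poly_eq[OF gi n] C_def using g
      by (simp add: product_minus)
    then have "Fi.normalize (?ev C) = binomial_poly (F i) n (g i)"
      using Fi.normalize_polynomial[of "carrier (F i)"] Fi.binomial_poly_closed[OF gi, of n]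
      unfolding univ_poly_carrier[symmetric] by metis
    then have "binomial_poly (F i) n (g i) = ?ev A \<otimes>\<^bsub>poly_ring (F i)\<^esub> ?ev B"
      unfolding univ_poly_mult ev.poly_mult_hom'[OF A(1) B(1), symmetric] D_def[symmetric] DC by (rule sym)
    moreover have "?ev A \<in> carrier (poly_ring (F i))" "?ev B \<in> carrier (poly_ring (F i))"
      using carr[OF A(1)] carr[OF B(1)] i(2,3)
      unfolding univ_poly_carrier[symmetric] polynomial_def by (auto simp: hd_map)
    moreover have "degree (?ev A) > 0" "degree (?ev B) > 0"
      using a(2) c(2) unfolding A(2)[symmetric] B(2)[symmetric] by simp_all
    ultimately show False
      using Fi.not_pirreducible_product i(4) by metis
  qed
  show ?thesis
  proof (rule K.pirreducibleI[OF K.carrier_is_subring b(1) b0])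
    show "?b \<notin> Units ?R"
      unfolding K.univ_poly_units'[OF K.carrier_is_subfield] b(2) using n by simp
    fix a c assume ac: "a \<in> carrier ?R" "c \<in> carrier ?R" "?b = a \<otimes>\<^bsub>?R\<^esub> c"
    have nonzero: "a \<noteq> []" "c \<noteq> []"
      using K.poly_ring_degree_mult(2,3)[OF ac(1,2), folded ac(3), OF b0] .
    show "a \<in> Units ?R \<or> c \<in> Units ?R"
    proof (rule ccontr)
      assume "\<not> (a \<in> Units ?R \<or> c \<in> Units ?R)"
      then have "degree a > 0" "degree c > 0"
        unfolding K.univ_poly_units'[OF K.carrier_is_subfield] using ac(1,2) nonzero by auto
      then show False
        using no_factors[OF ac(1) _ ac(2) _ ac(3)] by blast
    qed
  qed
qed

end

section \<open>Irreducible binomials over pseudofinite fields\<close>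

text \<open>Keeps condition (1) from being vacuous. Cyclicity of the multiplicative group is carried
  over from natural powers in \<open>mult_of\<close> to \<open>generate\<close> in
  \<open>units_of\<close>.\<close>

lemma (in field) exists_group_generator:
  assumes "finite (carrier R)"
  shows "\<exists>a. group_generator (units_of R) a"
proof -
  interpret G: group "units_of R"
    by (rule units_group)
  obtain a where a: "a \<in> carrier (Multiplicative_Group.mult_of R)" "carrier (Multiplicative_Group.mult_of R) = {a [^] i | i :: nat. i \<in> UNIV}"
    using finite_field_mult_group_has_gen[OF assms] by (rule bexE)
  have aU: "a \<in> carrier (units_of R)" "a \<in> Units R"
    using a(1) by (simp_all add: units_of_carrier field_Units)
  have "carrier (units_of R) \<subseteq> generate (units_of R) {a}"
  proof
    fix x assume "x \<in> carrier (units_of R)"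
    then have "x \<in> carrier (Multiplicative_Group.mult_of R)"
      by (simp add: units_of_carrier field_Units)
    then obtain i :: nat where "x = a [^]\<^bsub>units_of R\<^esub> i"
      unfolding a(2) units_of_pow[OF aU(2)] by blast
    then show "x \<in> generate (units_of R) {a}"
      unfolding G.generate_pow[OF aU(1)] int_pow_int[symmetric] by blast
  qed
  then show ?thesis
    using aU(1) G.generate_incl[of "{a}"] unfolding group_generator_def by blast
qed

lemma (in field) group_generator_units_ofD:
  assumes "finite (carrier R)" "group_generator (units_of R) a"
  shows "a \<in> carrier R" "a \<noteq> \<zero>" "group.ord (units_of R) a = card (carrier R) - 1"
proof -
  interpret G: group "units_of R"
    by (rule units_group)
  have a: "a \<in> carrier (units_of R)" "generate (units_of R) {a} = carrier (units_of R)"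
    using assms(2) by (simp_all add: group_generator_def)
  then show "a \<in> carrier R" "a \<noteq> \<zero>"
    by (simp_all add: units_of_carrier field_Units)
  show "G.ord a = card (carrier R) - 1"
    using G.generate_pow_card[OF a(1)] assms(1) unfolding a(2)
    by (simp add: units_of_carrier field_Units)
qed

theorem theorem2p4:
  fixes U :: "nat filter"
    and q :: "nat \<Rightarrow> nat"
    and F :: "nat \<Rightarrow> ('a, 'b) ring_scheme"
    and n :: nat
  assumes "ultrafilter U" and "nonprincipal U"
    and "\<And>k. primepow (q k)"
    and "filterlim q at_top sequentially"
    and "\<And>k. field (F k)"
    and "\<And>k. finite (carrier (F k))"
    and "\<And>k. card (carrier (F k)) = q k"
    and "n > 0"
  defines "FU \<equiv> ultraproduct U F"
  shows "((\<forall>g. (\<forall>k. group_generator (units_of (F k)) (g k)) \<longrightarrow>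
            pirreducible\<^bsub>FU\<^esub> (carrier FU) (binomial_poly FU n (ultra_class U F g)))
          \<longleftrightarrow> (\<exists>g \<in> carrier FU. pirreducible\<^bsub>FU\<^esub> (carrier FU) (binomial_poly FU n g)))
       \<and> ((\<exists>g \<in> carrier FU. pirreducible\<^bsub>FU\<^esub> (carrier FU) (binomial_poly FU n g))
          \<longleftrightarrow> eventually (\<lambda>k. (\<forall>p \<in> prime_factors n. p dvd q k - 1) \<and>
                 (4 dvd n \<longrightarrow> 4 dvd q k - 1)) U)"
    (is "(?all \<longleftrightarrow> ?ex) \<and> (?ex \<longleftrightarrow> eventually ?div U)")
proof -
  interpret field_ultraproduct U F
    by (rule field_ultraproduct.intro) (use assms in auto)
  interpret FU: field FU
    unfolding FU_def by (rule field_K)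
  interpret cls: ring_hom_ring P FU cls
    unfolding FU_def by (rule cls_hom)
  have fin: "finite (carrier (F k))" and card: "card (carrier (F k)) = q k" for k
    using assms(6,7) by simp_all
  \<comment> \<open>(1) implies (2): apply (1) to some sequence of generators.\<close>
  have "?ex" if all: ?all
  proof -
    obtain g where g: "\<And>k. group_generator (units_of (F k)) (g k)"
      using field.exists_group_generator[OF fields fin] by metis
    then have "g \<in> carrier P"
      using field.group_generator_units_ofD(1)[OF fields fin] by (simp add: product_carrier)
    then show ?ex
      using all g cls.hom_closed by blast
  qed
  \<comment> \<open>(3) implies (1): the binomials over the finite factors are irreducible on a set
    of the ultrafilter.\<close>
  moreover have "?all" if ev: "eventually ?div U"
  proof (intro allI impI)
    fix g assume "\<forall>k. group_generator (units_of (F k)) (g k)"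
    then have g: "g k \<in> carrier (F k)" "g k \<noteq> \<zero>\<^bsub>F k\<^esub>"
      "group.ord (units_of (F k)) (g k) = card (carrier (F k)) - 1" for k
      using field.group_generator_units_ofD[OF fields fin] by blast+
    have "eventually (\<lambda>k. pirreducible\<^bsub>F k\<^esub> (carrier (F k)) (binomial_poly (F k) n (g k))) U"
      using ev
    proof (rule eventually_mono)
      fix k assume k: "?div k"
      show "pirreducible\<^bsub>F k\<^esub> (carrier (F k)) (binomial_poly (F k) n (g k))"
      proof (rule field.binomial_poly_irreducible[OF fields fin g(1,2) \<open>n > 0\<close> g(3)])
        fix p assume "Factorial_Ring.prime p" "p dvd n"
        then show "p dvd card (carrier (F k)) - 1"
          using k \<open>n > 0\<close> by (simp add: card in_prime_factors_iff)
      qed (use k in \<open>simp add: card\<close>)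
    qed
    then show "pirreducible\<^bsub>FU\<^esub> (carrier FU) (binomial_poly FU n (cls g))"
      unfolding FU_def using g(1) \<open>n > 0\<close>
      by (intro binomial_poly_irreducible_transfer) (simp_all add: product_carrier)
  qed
  \<comment> \<open>(2) implies (3): each failing divisibility makes every binomial of degree
    \<open>n\<close> over \<open>FU\<close> reducible.\<close>
  moreover have "eventually ?div U" if ex: ?ex
  proof -
    obtain a where a: "a \<in> carrier FU" "pirreducible\<^bsub>FU\<^esub> (carrier FU) (binomial_poly FU n a)"
      using ex by blast
    \<comment> \<open>Where p does not divide q_k - 1, it is coprime to it and every element is a
      p-th power; this passes to \<open>FU\<close>.\<close>
    have "eventually (\<lambda>k. p dvd q k - 1) U" if p: "p \<in> prime_factors n" for p
    proof (rule ccontr)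
      assume "\<not> eventually (\<lambda>k. p dvd q k - 1) U"
      then have "eventually (\<lambda>k. \<not> p dvd q k - 1) U"
        by (simp only: not_eventually_iff)
      then have "eventually (\<lambda>k. \<forall>x\<in>carrier (F k). \<exists>y\<in>carrier (F k). x = y [^]\<^bsub>F k\<^esub> p) U"
      proof (rule eventually_mono, intro ballI)
        fix k x assume "\<not> p dvd q k - 1" and x: "x \<in> carrier (F k)"
        then have "coprime p (card (carrier (F k)) - 1)"
          using p by (simp add: card prime_imp_coprime in_prime_factors_iff)
        then show "\<exists>y\<in>carrier (F k). x = y [^]\<^bsub>F k\<^esub> p"
          using field.finite_field_pow_surj[OF fields fin _ _ x] p
          by (simp add: in_prime_factors_iff prime_gt_0_nat)
      qed
      then obtain b where b: "b \<in> carrier FU" "a = b [^]\<^bsub>FU\<^esub> p"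
        using pow_surj_transfer a(1) unfolding FU_def by blast
      obtain m where m: "n = p * m"
        using p by (auto simp: in_prime_factors_iff elim: dvdE)
      have "p > 1"
        using p prime_gt_1_nat by blast
      moreover have "m > 0"
        using m \<open>n > 0\<close> by simp
      ultimately show False
        using FU.not_pirreducible_binomial_of_power[OF b(1)] a(2) unfolding b(2) m by blast
    qed
    then have "eventually (\<lambda>k. \<forall>p\<in>prime_factors n. p dvd q k - 1) U"
      by (simp add: eventually_ball_finite)
    moreover have "eventually (\<lambda>k. 4 dvd n \<longrightarrow> 4 dvd q k - 1) U"
    proof (rule ccontr)
      assume "\<not> eventually (\<lambda>k. 4 dvd n \<longrightarrow> 4 dvd q k - 1) U"
      then have ev: "eventually (\<lambda>k. \<not> (4 dvd n \<longrightarrow> 4 dvd q k - 1)) U"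
        by (simp only: not_eventually_iff)
      \<comment> \<open>This does not depend on the index, so a single index from a set of the
        ultrafilter suffices.\<close>
      then have "4 dvd n"
        using eventually_happens'[OF not_bot] by blast
      have "eventually (\<lambda>k. \<forall>x\<in>carrier (F k). \<exists>y\<in>carrier (F k).
          x = y \<otimes>\<^bsub>F k\<^esub> y \<or> \<ominus>\<^bsub>F k\<^esub> x = y \<otimes>\<^bsub>F k\<^esub> y) U"
        using ev
      proof (rule eventually_mono, intro ballI)
        fix k x assume "\<not> (4 dvd n \<longrightarrow> 4 dvd q k - 1)" "x \<in> carrier (F k)"
        then show "\<exists>y\<in>carrier (F k). x = y \<otimes>\<^bsub>F k\<^esub> y \<or> \<ominus>\<^bsub>F k\<^esub> x = y \<otimes>\<^bsub>F k\<^esub> y"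
          using field.finite_field_square_or_minus_square[OF fields fin, of k x]
          unfolding card by blast
      qed
      then have "\<exists>y\<in>carrier FU. x = y \<otimes>\<^bsub>FU\<^esub> y \<or> \<ominus>\<^bsub>FU\<^esub> x = y \<otimes>\<^bsub>FU\<^esub> y"
        if "x \<in> carrier FU" for x
        using square_or_minus_square_transfer that unfolding FU_def by blast
      then show False
        using FU.not_pirreducible_binomial_of_four_dvd[OF _ a(1) \<open>n > 0\<close> \<open>4 dvd n\<close>] a(2) by blast
    qed
    ultimately show ?thesis
      by (rule eventually_conj)
  qed
  ultimately show ?thesis
    by blast
qed

end
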